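(* Let $a<b$ and $\alpha,\beta$ be real numbers, and let $X=C([a,b])$ with the norm $\|x\|_\infty=\sup_{t\in[a,b]}|x(t)|$. Let $F\colon[a,b]\times\mathbb R\to\mathbb R$ satisfy $|F(t,u)-F(t,v)|\le L_F|u-v|$ for all $t\in[a,b]$, $u,v\in\mathbb R$, with an explicit constant $L_F\ge0$, and $M_{F_0}:=\sup_{t\in[a,b]}|F(t,0)|<\infty$. Let $\ell(t):=\alpha+\frac{t-a}{b-a}(\beta-\alpha)$, let $G$ be the Dirichlet Green kernel on $[a,b]$, and define $$(Tx)(t):=\ell(t)+\int_a^bG(t,s)\,F(s,x(s))\,ds ,\qquad x\in X,\ t\in[a,b].$$ Assume $M_G:=\sup_{t\in[a,b]}\int_a^b|G(t,s)|\,ds<\infty$ and $L:=L_FM_G<1$. Put $$R:=\frac{\|\ell\|_\infty+M_G\,M_{F_0}}{1-L},\qquad C:=\{x\in X:\|x\|_\infty\le R\}.$$ Then the Dirichlet problem $$x''(t)=F(t,x(t))\quad (t\in[a,b]),\qquad x(a)=\alpha,\quad x(b)=\beta,$$ has a unique solution $x^\ast\in C$. For any $x_0\in C$, the Picard iterates $x_{n+1}:=Tx_n$ satisfy $$\|x_n-x^\ast\|_\infty\le\frac{L^{n}}{1-L}\,\delta_0,\qquad\delta_0:=\|Tx_0-x_0\|_\infty ,$$ for all $n\in\mathbb N$. In particular, for $\varepsilon>0$, if $n\ge N_{\mathrm{geo}}(\varepsilon;L,\delta_0)$, then $\|x_n-x^\ast\|_\infty\le\varepsilon$.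
   Context: $\mathbb N=\{0,1,2,\dots\}$, and for $\varepsilon>0$ $$N_{\mathrm{geo}}(\varepsilon;L,\delta_0):=\min\Bigl\{n\in\mathbb N:\ \frac{L^{n}}{1-L}\,\delta_0\le\varepsilon\Bigr\}.$$ The Dirichlet Green kernel of $x\mapsto x''$ on $[a,b]$ is $$G(t,s)=-\frac{(s-a)(b-t)}{b-a}\ \ (a\le s\le t\le b),\qquad G(t,s)=-\frac{(t-a)(b-s)}{b-a}\ \ (a\le t\le s\le b).$$
   Formalization: Since F need not be continuous in t, a pointwise solution may fail to exist; the solution is taken with x' absolutely continuous and x''=F(t,x) almost everywhere, and x''=F(t,x) at every t is claimed only when F(·,u) is continuous on [a,b] for each u. The integrals defining T are assumed to exist. *)

theory Defs
  imports "HOL-Analysis.Analysis"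
begin

text \<open>The space \<open>C([a,b])\<close>. Its elements are total functions that take the value \<open>undefined\<close>
  off \<open>[a,b]\<close>, so that equality in the space is equality of functions on \<open>[a,b]\<close>.\<close>
definition cont_space :: "real \<Rightarrow> real \<Rightarrow> (real \<Rightarrow> real) set" where
  "cont_space a b = {x \<in> extensional {a..b}. continuous_on {a..b} x}"

definition sup_norm :: "real \<Rightarrow> real \<Rightarrow> (real \<Rightarrow> real) \<Rightarrow> real" where
  "sup_norm a b x = (SUP t\<in>{a..b}. \<bar>x t\<bar>)"

definition green :: "real \<Rightarrow> real \<Rightarrow> real \<Rightarrow> real \<Rightarrow> real" where
  "green a b t s =
     (if s \<le> t then - ((s - a) * (b - t) / (b - a)) else - ((t - a) * (b - s) / (b - a)))"

definition affine_interp :: "real \<Rightarrow> real \<Rightarrow> real \<Rightarrow> real \<Rightarrow> real \<Rightarrow> real" where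
  "affine_interp a b \<alpha> \<beta> t = \<alpha> + (t - a) / (b - a) * (\<beta> - \<alpha>)"

definition dirichlet_op ::
  "real \<Rightarrow> real \<Rightarrow> real \<Rightarrow> real \<Rightarrow> (real \<Rightarrow> real \<Rightarrow> real) \<Rightarrow> (real \<Rightarrow> real) \<Rightarrow> real \<Rightarrow> real" where
  "dirichlet_op a b \<alpha> \<beta> F x =
     (\<lambda>t\<in>{a..b}. affine_interp a b \<alpha> \<beta> t + integral {a..b} (\<lambda>s. green a b t s * F s (x s)))"

text \<open>Classical solutions: \<open>x''(t) = F(t, x(t))\<close> at every \<open>t \<in> [a,b]\<close>, with one-sided
  derivatives at the end points. The function \<open>y\<close> is \<open>x'\<close>.\<close>
definition classical_solution ::
  "real \<Rightarrow> real \<Rightarrow> real \<Rightarrow> real \<Rightarrow> (real \<Rightarrow> real \<Rightarrow> real) \<Rightarrow> (real \<Rightarrow> real) \<Rightarrow> bool" where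
  "classical_solution a b \<alpha> \<beta> F x \<longleftrightarrow>
     (\<exists>y. (\<forall>t\<in>{a..b}. (x has_real_derivative y t) (at t within {a..b})) \<and>
          (\<forall>t\<in>{a..b}. (y has_real_derivative F t (x t)) (at t within {a..b}))) \<and>
     x a = \<alpha> \<and> x b = \<beta>"

definition abs_continuous :: "real \<Rightarrow> real \<Rightarrow> (real \<Rightarrow> real) \<Rightarrow> bool" where
  "abs_continuous a b f \<longleftrightarrow>
     (\<forall>\<epsilon>>0. \<exists>\<delta>>0. \<forall>D :: (real \<times> real) set.
        finite D \<and> (\<forall>(c, d)\<in>D. a \<le> c \<and> c \<le> d \<and> d \<le> b) \<and>
        disjoint_family_on (\<lambda>(c, d). {c<..<d}) D \<and> (\<Sum>(c, d)\<in>D. d - c) < \<delta>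
        \<longrightarrow> (\<Sum>(c, d)\<in>D. \<bar>f d - f c\<bar>) < \<epsilon>)"

text \<open>Caratheodory solutions, the standard notion when \<open>F\<close> need not be continuous in \<open>t\<close>:
  \<open>x\<close> is differentiable on \<open>[a,b]\<close>, \<open>x'\<close> is absolutely continuous, and the equation holds
  almost everywhere.\<close>
definition caratheodory_solution ::
  "real \<Rightarrow> real \<Rightarrow> real \<Rightarrow> real \<Rightarrow> (real \<Rightarrow> real \<Rightarrow> real) \<Rightarrow> (real \<Rightarrow> real) \<Rightarrow> bool" where
  "caratheodory_solution a b \<alpha> \<beta> F x \<longleftrightarrow>
     (\<exists>y. (\<forall>t\<in>{a..b}. (x has_real_derivative y t) (at t within {a..b})) \<and>
          abs_continuous a b y \<and>
          (AE t in lebesgue. t \<in> {a..b} \<longrightarrow>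
             (y has_real_derivative F t (x t)) (at t within {a..b}))) \<and>
     x a = \<alpha> \<and> x b = \<beta>"

definition N_geo :: "real \<Rightarrow> real \<Rightarrow> real \<Rightarrow> nat" where
  "N_geo \<epsilon> L \<delta>\<^sub>0 = (LEAST n. L ^ n / (1 - L) * \<delta>\<^sub>0 \<le> \<epsilon>)"

end

theory Submission
  imports Defs
begin

text \<open>
  For \<open>x\<close> in \<open>C([a,b])\<close> put \<open>h(s) = F(s, x(s))\<close>. It is bounded, and integrable because the kernel does
  not vanish inside the square. The integral of \<open>G(t,s) h(s)\<close> over \<open>s\<close> equals
  \<open>K(t) - (t - a)/(b - a) K(b)\<close>, where \<open>K\<close> is the twice iterated integral of \<open>h\<close> from \<open>a\<close>. So \<open>Tx\<close> is
  \<open>C\<^sup>1\<close> with Lipschitz derivative, and by Lebesgue differentiation \<open>(Tx)'' = h\<close> almost everywhere.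
  Conversely, an absolutely continuous function whose derivative vanishes almost everywhere is
  constant, so Caratheodory solutions are fixed points of \<open>T\<close>. Since \<open>T\<close> contracts the whole space
  with constant \<open>L\<close>, Banach's theorem applies, and the a priori estimate for the fixed point is
  exactly membership in \<open>C\<close>.
\<close>

section \<open>Absolute continuity\<close>

text \<open>Intervals of total length below \<open>\<epsilon> / M\<close> have increments adding up
  to less than \<epsilon>. This supplies absolute continuity both of indefinite integrals of bounded
  functions and of first derivatives of classical solutions.\<close>

lemma abs_continuous_lipschitz:
  assumes "\<And>s t. \<lbrakk>s \<in> {a..b}; t \<in> {a..b}\<rbrakk> \<Longrightarrow> \<bar>f t - f s\<bar> \<le> B * \<bar>t - s\<bar>"
  shows "abs_continuous a b f"
  unfolding abs_continuous_def
proof (intro allI impI)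
  fix \<epsilon> :: real assume "\<epsilon> > 0"
  \<comment> \<open>No sign of \<open>B\<close> is assumed; the shift makes \<open>M\<close> a
    positive divisor.\<close>
  define M where "M = \<bar>B\<bar> + 1"
  have M: "M > 0" "B \<le> M" by (auto simp: M_def)
  show "\<exists>\<delta>>0. \<forall>D. finite D \<and> (\<forall>(c, d)\<in>D. a \<le> c \<and> c \<le> d \<and> d \<le> b) \<and>
      disjoint_family_on (\<lambda>(c, d). {c<..<d}) D \<and> (\<Sum>(c, d)\<in>D. d - c) < \<delta>
      \<longrightarrow> (\<Sum>(c, d)\<in>D. \<bar>f d - f c\<bar>) < \<epsilon>"
  proof (rule exI[of _ "\<epsilon> / M"], intro conjI allI impI)
    show "\<epsilon> / M > 0" using \<open>\<epsilon> > 0\<close> M by simp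
    fix D :: "(real \<times> real) set"
    assume D: "finite D \<and> (\<forall>(c, d)\<in>D. a \<le> c \<and> c \<le> d \<and> d \<le> b) \<and>
      disjoint_family_on (\<lambda>(c, d). {c<..<d}) D \<and> (\<Sum>(c, d)\<in>D. d - c) < \<epsilon> / M"
    have "(\<Sum>(c, d)\<in>D. \<bar>f d - f c\<bar>) \<le> (\<Sum>(c, d)\<in>D. M * (d - c))"
    proof (rule sum_mono, clarify)
      fix c d assume "(c, d) \<in> D"
      then have cd: "a \<le> c" "c \<le> d" "d \<le> b" using D by auto
      then have "\<bar>f d - f c\<bar> \<le> B * (d - c)" using assms[of c d] by auto
      also have "\<dots> \<le> M * (d - c)" using M cd by (intro mult_right_mono) auto
      finally show "\<bar>f d - f c\<bar> \<le> M * (d - c)" .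
    qed
    also have "\<dots> = M * (\<Sum>(c, d)\<in>D. d - c)"
      by (simp add: sum_distrib_left split_def)
    also have "\<dots> < \<epsilon>" using D M by (simp add: field_simps)
    finally show "(\<Sum>(c, d)\<in>D. \<bar>f d - f c\<bar>) < \<epsilon>" .
  qed
qed

lemma abs_continuous_diff:
  assumes f: "abs_continuous a b f" and g: "abs_continuous a b g"
  shows "abs_continuous a b (\<lambda>t. f t - g t)"
  unfolding abs_continuous_def
proof (intro allI impI)
  fix \<epsilon> :: real assume "\<epsilon> > 0"
  then have e2: "\<epsilon> / 2 > 0" by simp
  obtain \<delta>1 where \<delta>1: "\<delta>1 > 0" "\<And>D. \<lbrakk>finite D; \<forall>(c, d)\<in>D. a \<le> c \<and> c \<le> d \<and> d \<le> b;
      disjoint_family_on (\<lambda>(c, d). {c<..<d}) D; (\<Sum>(c, d)\<in>D. d - c) < \<delta>1\<rbrakk>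
      \<Longrightarrow> (\<Sum>(c, d)\<in>D. \<bar>f d - f c\<bar>) < \<epsilon> / 2"
    using f e2 unfolding abs_continuous_def by meson
  obtain \<delta>2 where \<delta>2: "\<delta>2 > 0" "\<And>D. \<lbrakk>finite D; \<forall>(c, d)\<in>D. a \<le> c \<and> c \<le> d \<and> d \<le> b;
      disjoint_family_on (\<lambda>(c, d). {c<..<d}) D; (\<Sum>(c, d)\<in>D. d - c) < \<delta>2\<rbrakk>
      \<Longrightarrow> (\<Sum>(c, d)\<in>D. \<bar>g d - g c\<bar>) < \<epsilon> / 2"
    using g e2 unfolding abs_continuous_def by meson
  show "\<exists>\<delta>>0. \<forall>D. finite D \<and> (\<forall>(c, d)\<in>D. a \<le> c \<and> c \<le> d \<and> d \<le> b) \<and>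
      disjoint_family_on (\<lambda>(c, d). {c<..<d}) D \<and> (\<Sum>(c, d)\<in>D. d - c) < \<delta>
      \<longrightarrow> (\<Sum>(c, d)\<in>D. \<bar>f d - g d - (f c - g c)\<bar>) < \<epsilon>"
  proof (rule exI[of _ "min \<delta>1 \<delta>2"], intro conjI allI impI)
    show "min \<delta>1 \<delta>2 > 0" using \<delta>1 \<delta>2 by simp
    fix D :: "(real \<times> real) set"
    assume D: "finite D \<and> (\<forall>(c, d)\<in>D. a \<le> c \<and> c \<le> d \<and> d \<le> b) \<and>
      disjoint_family_on (\<lambda>(c, d). {c<..<d}) D \<and> (\<Sum>(c, d)\<in>D. d - c) < min \<delta>1 \<delta>2"
    have "(\<Sum>(c, d)\<in>D. \<bar>f d - g d - (f c - g c)\<bar>)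
        \<le> (\<Sum>(c, d)\<in>D. \<bar>f d - f c\<bar> + \<bar>g d - g c\<bar>)"
      by (rule sum_mono) auto
    also have "\<dots> = (\<Sum>(c, d)\<in>D. \<bar>f d - f c\<bar>) + (\<Sum>(c, d)\<in>D. \<bar>g d - g c\<bar>)"
      by (simp add: split_def sum.distrib)
    also have "\<dots> < \<epsilon>" using \<delta>1(2)[of D] \<delta>2(2)[of D] D by auto
    finally show "(\<Sum>(c, d)\<in>D. \<bar>f d - g d - (f c - g c)\<bar>) < \<epsilon>" .
  qed
qed

lemma abs_continuous_subinterval:
  assumes "abs_continuous a b f" "a \<le> c" "d \<le> b"
  shows "abs_continuous c d f"
  unfolding abs_continuous_def
proof (intro allI impI)
  fix \<epsilon> :: real assume "\<epsilon> > 0"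
  then obtain \<delta> where \<delta>: "\<delta> > 0" "\<And>D. \<lbrakk>finite D; \<forall>(u, v)\<in>D. a \<le> u \<and> u \<le> v \<and> v \<le> b;
      disjoint_family_on (\<lambda>(u, v). {u<..<v}) D; (\<Sum>(u, v)\<in>D. v - u) < \<delta>\<rbrakk>
      \<Longrightarrow> (\<Sum>(u, v)\<in>D. \<bar>f v - f u\<bar>) < \<epsilon>"
    using assms(1) unfolding abs_continuous_def by meson
  have *: "\<forall>(u, v)\<in>D. a \<le> u \<and> u \<le> v \<and> v \<le> b"
    if "\<forall>(u, v)\<in>D. c \<le> u \<and> u \<le> v \<and> v \<le> d" for D
    using that assms by force
  show "\<exists>\<delta>>0. \<forall>D. finite D \<and> (\<forall>(u, v)\<in>D. c \<le> u \<and> u \<le> v \<and> v \<le> d) \<and>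
      disjoint_family_on (\<lambda>(u, v). {u<..<v}) D \<and> (\<Sum>(u, v)\<in>D. v - u) < \<delta>
      \<longrightarrow> (\<Sum>(u, v)\<in>D. \<bar>f v - f u\<bar>) < \<epsilon>"
    by (intro exI[of _ \<delta>] conjI allI impI \<delta>(1), elim conjE, rule \<delta>(2)) (auto dest!: *)
qed

section \<open>Functions whose derivative vanishes off a null set\<close>

text \<open>Outer regularity gives an open set exceeding \<open>N\<close> by a set of small measure,
  and \<open>N\<close> itself adds no measure.\<close>

lemma negligible_subset_small_open:
  fixes N :: "real set"
  assumes "negligible N" "\<delta> > 0"
  obtains U where "open U" "N \<subseteq> U" "U \<in> lmeasurable" "measure lebesgue U < \<delta>"
proof -
  have N: "N \<in> null_sets lebesgue" using assms negligible_iff_null_sets by auto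
  then have "N \<in> sets lebesgue" by auto
  then obtain U where U: "open U" "N \<subseteq> U" "(U - N) \<in> lmeasurable" "emeasure lebesgue (U - N) < ennreal \<delta>"
    using sets_lebesgue_outer_open[OF _ \<open>\<delta> > 0\<close>] by metis
  have "U = (U - N) \<union> N" using U by auto
  then have "U \<in> lmeasurable"
    using U(3) assms(1) negligible_imp_measurable fmeasurable.Un by metis
  moreover have "emeasure lebesgue U = emeasure lebesgue (U - N)"
    using N U by (simp add: emeasure_Diff_null_set)
  then have "measure lebesgue U < \<delta>"
    using U(4) \<open>U \<in> lmeasurable\<close>
    by (metis emeasure_eq_measure2 ennreal_less_iff measure_nonneg)
  ultimately show thesis using that U by blast
qed

text \<open>The lengths are the measures of disjoint subsets of \<open>U\<close>. This turns the
  smallness of an open cover into the length condition of absolute continuity.\<close>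

lemma sum_lengths_le_measure:
  fixes D :: "(real \<times> real) set"
  assumes "finite D" "\<forall>(c, d)\<in>D. c \<le> d \<and> {c<..<d} \<subseteq> U"
    and "disjoint_family_on (\<lambda>(c, d). {c<..<d}) D" "U \<in> lmeasurable"
  shows "(\<Sum>(c, d)\<in>D. d - c) \<le> measure lebesgue U"
proof -
  let ?I = "\<lambda>(c::real, d). {c<..<d}"
  have fin: "emeasure lebesgue (?I i) \<noteq> \<infinity>" for i
    by (cases i; cases "fst i \<le> snd i") auto
  have "(\<Sum>(c, d)\<in>D. d - c) = (\<Sum>i\<in>D. measure lebesgue (?I i))"
    using assms(2) by (intro sum.cong) auto
  also have "\<dots> = measure lebesgue (\<Union>i\<in>D. ?I i)"
    using assms(1,3) fin by (subst measure_finite_Union) auto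
  also have "\<dots> \<le> measure lebesgue U"
    using assms(1,2,4) by (intro measure_mono_fmeasurable) auto
  finally show ?thesis .
qed

text \<open>Tags at points of vanishing derivative contribute little by the straddle estimate; the
  intervals tagged in the null set lie in an open set of small measure.\<close>
lemma abs_continuous_zero_derivative_endpoints:
  fixes f :: "real \<Rightarrow> real"
  assumes "a \<le> b" and ac: "abs_continuous a b f" and N: "negligible N"
    and der: "\<And>t. t \<in> {a..b} - N \<Longrightarrow> (f has_real_derivative 0) (at t within {a..b})"
  shows "f b = f a"
proof -
  \<comment> \<open>The term \<open>\<epsilon> * (b - a)\<close> pays for the tags outside
    \<open>N\<close>, the single \<epsilon> for the tags in \<open>N\<close>.\<close>
  have main: "\<bar>f b - f a\<bar> \<le> \<epsilon> * (b - a) + \<epsilon>" if "\<epsilon> > 0" for \<epsilon>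
  proof -
    obtain \<delta> where \<delta>: "\<delta> > 0" "\<And>D. \<lbrakk>finite D; \<forall>(c, d)\<in>D. a \<le> c \<and> c \<le> d \<and> d \<le> b;
        disjoint_family_on (\<lambda>(c, d). {c<..<d}) D; (\<Sum>(c, d)\<in>D. d - c) < \<delta>\<rbrakk>
        \<Longrightarrow> (\<Sum>(c, d)\<in>D. \<bar>f d - f c\<bar>) < \<epsilon>"
      using ac \<open>\<epsilon> > 0\<close> unfolding abs_continuous_def by meson
    obtain U where U: "open U" "N \<subseteq> U" "U \<in> lmeasurable" "measure lebesgue U < \<delta>"
      using negligible_subset_small_open[OF N \<delta>(1)] by blast
    \<comment> \<open>These radii define the gauge. At a tag in \<open>N\<close> the ball stays in
      the small open set; at any other tag in \<open>[a,b]\<close> the zero derivative bounds the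
      slopes from the tag by \<epsilon>.\<close>
    have r: "\<exists>r>0. (t \<in> N \<longrightarrow> ball t r \<subseteq> U) \<and> (t \<in> {a..b} - N \<longrightarrow>
        (\<forall>s\<in>{a..b}. \<bar>s - t\<bar> < r \<longrightarrow> \<bar>f s - f t\<bar> \<le> \<epsilon> * \<bar>s - t\<bar>))" for t
    proof (cases "t \<in> N")
      case True
      then show ?thesis using U open_contains_ball by blast
    next
      case False
      show ?thesis
      proof (cases "t \<in> {a..b}")
        case True
        then have "(f has_derivative (\<lambda>h. 0)) (at t within {a..b})"
          using der[of t] False by (simp add: has_field_derivative_def lambda_zero)
        then have "\<exists>r>0. \<forall>s\<in>{a..b}. \<bar>s - t\<bar> < r \<longrightarrow> \<bar>f s - f t\<bar> \<le> \<epsilon> * \<bar>s - t\<bar>"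
          using \<open>\<epsilon> > 0\<close> by (simp add: has_derivative_within_alt)
        then show ?thesis using False by blast
      qed (use False in \<open>auto intro: exI[of _ 1]\<close>)
    qed
    obtain r where r0: "\<And>t. r t > 0" and rN: "\<And>t. t \<in> N \<Longrightarrow> ball t (r t) \<subseteq> U"
      and rd: "\<And>t s. \<lbrakk>t \<in> {a..b} - N; s \<in> {a..b}; \<bar>s - t\<bar> < r t\<rbrakk> \<Longrightarrow> \<bar>f s - f t\<bar> \<le> \<epsilon> * \<bar>s - t\<bar>"
      using r by metis
    have "gauge (\<lambda>t. ball t (r t))" using r0 by (auto simp: gauge_def)
    then obtain p where p: "p tagged_division_of {a..b}" "(\<lambda>t. ball t (r t)) fine p"
      using fine_division_exists_real by blast
    have pfin: "finite p" using p by blast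
    have K: "\<exists>c d. K = {c..d} \<and> c \<le> t \<and> t \<le> d \<and> a \<le> c \<and> d \<le> b \<and> Inf K = c \<and> Sup K = d \<and> K \<subseteq> ball t (r t)"
      if tK: "(t, K) \<in> p" for t K
    proof -
      obtain c d where cd: "K = cbox c d" using tagged_division_ofD(4)[OF p(1) tK] by auto
      moreover have "t \<in> K" "K \<subseteq> {a..b}" using tagged_division_ofD(2,3)[OF p(1) that] by auto
      moreover have "K \<subseteq> ball t (r t)" using p(2) that by (auto simp: fine_def)
      ultimately show ?thesis by auto
    qed
    define \<Delta> where "\<Delta> = (\<lambda>(t::real, K). f (Sup K) - f (Inf K))"
    \<comment> \<open>Degenerate pieces are left out: two different members of \<open>q\<close> with
      equal endpoints would share a nonempty open interval, contrary to disjoint interiors. So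
      passing to endpoint pairs by \<open>e\<close> merges no terms.\<close>
    define q where "q = {(t, K) \<in> p. t \<in> N \<and> Inf K < Sup K}"
    define e where "e = (\<lambda>(t::real, K::real set). (Inf K, Sup K))"
    have q: "q \<subseteq> p" "finite q"
      using finite_subset[OF _ pfin, of q] by (auto simp: q_def)
    have disj: "{Inf K<..<Sup K} \<inter> {Inf K'<..<Sup K'} = {}"
      if "(t, K) \<in> p" "(t', K') \<in> p" "(t, K) \<noteq> (t', K')" for t K t' K'
    proof -
      have "interior K \<inter> interior K' = {}"
        using tagged_division_ofD(5)[OF p(1)] that by blast
      moreover have "interior K = {Inf K<..<Sup K}" "interior K' = {Inf K'<..<Sup K'}"
        using K[OF that(1)] K[OF that(2)] by (metis interior_atLeastAtMost_real)+
      ultimately show ?thesis by simp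
    qed
    have inj: "inj_on e q"
    proof (rule inj_onI, clarify)
      fix t K t' K' assume *: "(t, K) \<in> q" "(t', K') \<in> q" "e (t, K) = e (t', K')"
      show "t = t' \<and> K = K'"
      proof (rule ccontr)
        assume "\<not> (t = t' \<and> K = K')"
        then have "{Inf K<..<Sup K} \<inter> {Inf K'<..<Sup K'} = {}"
          using * q(1) by (intro disj) auto
        then show False using * by (auto simp: q_def e_def)
      qed
    qed
    have "(\<Sum>(c, d)\<in>e ` q. \<bar>f d - f c\<bar>) < \<epsilon>"
    proof (rule \<delta>(2))
      show "finite (e ` q)" using q by simp
      show ab: "\<forall>(c, d)\<in>e ` q. a \<le> c \<and> c \<le> d \<and> d \<le> b"
        using K q(1) by (fastforce simp: e_def)
      show dis: "disjoint_family_on (\<lambda>(c, d). {c<..<d}) (e ` q)"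
        unfolding disjoint_family_on_def
      proof (intro ballI impI)
        fix i j assume "i \<in> e ` q" "j \<in> e ` q" and ij: "i \<noteq> j"
        then obtain t K t' K' where *: "(t, K) \<in> q" "(t', K') \<in> q"
            "i = (Inf K, Sup K)" "j = (Inf K', Sup K')"
          by (force simp: e_def)
        then have "(t, K) \<in> p" "(t', K') \<in> p" "(t, K) \<noteq> (t', K')" using q(1) ij by auto
        from disj[OF this]
        show "(\<lambda>(c, d). {c<..<d}) i \<inter> (\<lambda>(c, d). {c<..<d}) j = {}" using * by simp
      qed
      have "\<forall>(c, d)\<in>e ` q. c \<le> d \<and> {c<..<d} \<subseteq> U"
      proof (clarsimp simp: e_def)
        fix t K assume *: "(t, K) \<in> q"
        then have "(t, K) \<in> p" "t \<in> N" by (auto simp: q_def)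
        then show "Inf K \<le> Sup K \<and> {Inf K<..<Sup K} \<subseteq> U"
          using K[of t K] rN[of t] by fastforce
      qed
      then have "(\<Sum>(c, d)\<in>e ` q. d - c) \<le> measure lebesgue U"
        using sum_lengths_le_measure[OF _ _ dis U(3)] q by auto
      then show "(\<Sum>(c, d)\<in>e ` q. d - c) < \<delta>" using U by simp
    qed
    then have 1: "(\<Sum>i\<in>q. \<bar>\<Delta> i\<bar>) < \<epsilon>"
      unfolding sum.reindex[OF inj] by (simp add: \<Delta>_def e_def split_def)
    have len: "(\<Sum>(t, K)\<in>p. Sup K - Inf K) = b - a"
      using additive_tagged_division_1[OF \<open>a \<le> b\<close> p(1), of "\<lambda>x. x"] by simp
    have len0: "0 \<le> (case i of (t, K) \<Rightarrow> Sup K - Inf K)" if "i \<in> p" for i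
      using K that by (cases i) fastforce
    \<comment> \<open>A piece outside \<open>q\<close> tagged in \<open>N\<close> is degenerate and
      contributes zero. Otherwise both endpoints are compared with the tag; as the tag lies between
      them, the two distances add up to the length.\<close>
    have "\<bar>\<Delta> i\<bar> \<le> \<epsilon> * (case i of (t, K) \<Rightarrow> Sup K - Inf K)" if i: "i \<in> p - q" for i
    proof -
      obtain t K where tK: "i = (t, K)" by (cases i)
      with i obtain c d where cd: "K = {c..d}" "c \<le> t" "t \<le> d" "a \<le> c" "d \<le> b"
          "Inf K = c" "Sup K = d" "K \<subseteq> ball t (r t)"
        using K[of t K] by auto
      show ?thesis
      proof (cases "t \<in> N")
        case True
        then have "c = d" using i cd tK by (auto simp: q_def)
        then show ?thesis using tK cd by (simp add: \<Delta>_def)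
      next
        case False
        have "c \<in> K" "d \<in> K" using cd by auto
        then have "c \<in> ball t (r t)" "d \<in> ball t (r t)" using cd by blast+
        then have "\<bar>c - t\<bar> < r t" "\<bar>d - t\<bar> < r t" by (auto simp: dist_real_def)
        moreover have "t \<in> {a..b} - N" "c \<in> {a..b}" "d \<in> {a..b}" using False cd(2-5) by auto
        ultimately have "\<bar>f c - f t\<bar> \<le> \<epsilon> * \<bar>c - t\<bar>" "\<bar>f d - f t\<bar> \<le> \<epsilon> * \<bar>d - t\<bar>"
          using rd by blast+
        then have "\<bar>f d - f c\<bar> \<le> \<epsilon> * \<bar>c - t\<bar> + \<epsilon> * \<bar>d - t\<bar>" by linarith
        also have "\<dots> = \<epsilon> * (d - c)" using cd by (simp add: algebra_simps)
        finally show ?thesis using tK cd by (simp add: \<Delta>_def)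
      qed
    qed
    then have "(\<Sum>i\<in>p - q. \<bar>\<Delta> i\<bar>) \<le> (\<Sum>i\<in>p - q. \<epsilon> * (case i of (t, K) \<Rightarrow> Sup K - Inf K))"
      by (rule sum_mono)
    also have "\<dots> \<le> (\<Sum>i\<in>p. \<epsilon> * (case i of (t, K) \<Rightarrow> Sup K - Inf K))"
      using pfin len0 \<open>\<epsilon> > 0\<close> by (intro sum_mono2) auto
    also have "\<dots> = \<epsilon> * (b - a)" using len by (simp add: sum_distrib_left[symmetric])
    finally have 2: "(\<Sum>i\<in>p - q. \<bar>\<Delta> i\<bar>) \<le> \<epsilon> * (b - a)" .
    have "f b - f a = (\<Sum>i\<in>p. \<Delta> i)"
      using additive_tagged_division_1[OF \<open>a \<le> b\<close> p(1), of f] by (simp add: \<Delta>_def)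
    also have "\<bar>\<dots>\<bar> \<le> (\<Sum>i\<in>p. \<bar>\<Delta> i\<bar>)" by (rule sum_abs)
    also have "\<dots> = (\<Sum>i\<in>p - q. \<bar>\<Delta> i\<bar>) + (\<Sum>i\<in>q. \<bar>\<Delta> i\<bar>)"
      by (rule sum.subset_diff[OF q(1) pfin])
    finally show ?thesis using 1 2 by linarith
  qed
  have "\<bar>f b - f a\<bar> \<le> 0"
  proof (rule field_le_epsilon)
    fix e :: real assume "e > 0"
    \<comment> \<open>This choice of \<epsilon> makes the bound in \<open>main\<close> equal to
      \<open>e\<close>.\<close>
    have "\<bar>f b - f a\<bar> \<le> e / (b - a + 1) * (b - a) + e / (b - a + 1)"
      using main[of "e / (b - a + 1)"] \<open>e > 0\<close> \<open>a \<le> b\<close> by simp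
    also have "\<dots> = e / (b - a + 1) * (b - a + 1)" by (simp add: algebra_simps add_divide_distrib[symmetric])
    also have "\<dots> = e" using \<open>a \<le> b\<close> by simp
    finally show "\<bar>f b - f a\<bar> \<le> 0 + e" by simp
  qed
  then show ?thesis by simp
qed

text \<open>The endpoint form applies on \<open>[a,t]\<close>, which inherits absolute continuity
  and the derivative condition.\<close>

lemma abs_continuous_zero_derivative_const:
  fixes f :: "real \<Rightarrow> real"
  assumes "abs_continuous a b f" "negligible N"
    and "\<And>t. t \<in> {a..b} - N \<Longrightarrow> (f has_real_derivative 0) (at t within {a..b})"
    and "t \<in> {a..b}"
  shows "f t = f a"
proof (rule abs_continuous_zero_derivative_endpoints[of a t f N])
  show "abs_continuous a t f"
    using assms abs_continuous_subinterval[of a b f a t] by auto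
  show "(f has_real_derivative 0) (at s within {a..t})" if "s \<in> {a..t} - N" for s
    using assms(3)[of s] that assms(4) by (auto intro: DERIV_subset)
qed (use assms in auto)

section \<open>Indefinite integrals\<close>

lemma indefinite_integral_diff:
  fixes h :: "real \<Rightarrow> real"
  assumes "h integrable_on {a..b}" "a \<le> s" "s \<le> t" "t \<le> b"
  shows "integral {a..t} h - integral {a..s} h = integral {s..t} h"
proof -
  have "h integrable_on {a..t}" using assms by (auto intro: integrable_subinterval_real)
  from Henstock_Kurzweil_Integration.integral_combine[OF assms(2,3) this] show ?thesis by simp
qed

lemma abs_integral_le_const:
  fixes h :: "real \<Rightarrow> real"
  assumes "h integrable_on {s..t}" "\<And>u. u \<in> {s..t} \<Longrightarrow> \<bar>h u\<bar> \<le> B" "s \<le> t"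
  shows "\<bar>integral {s..t} h\<bar> \<le> B * (t - s)"
  using integral_norm_bound_integral[of h "{s..t}" "\<lambda>_. B"] assms
  by (simp add: mult.commute integrable_const_ivl)

lemma indefinite_integral_lipschitz:
  fixes h :: "real \<Rightarrow> real"
  assumes h: "h integrable_on {a..b}" and B: "\<And>u. u \<in> {a..b} \<Longrightarrow> \<bar>h u\<bar> \<le> B"
    and st: "s \<in> {a..b}" "t \<in> {a..b}"
  shows "\<bar>integral {a..t} h - integral {a..s} h\<bar> \<le> B * \<bar>t - s\<bar>"
proof -
  have *: "\<bar>integral {a..v} h - integral {a..u} h\<bar> \<le> B * (v - u)"
    if "a \<le> u" "u \<le> v" "v \<le> b" for u v
    using abs_integral_le_const[of h u v B] indefinite_integral_diff[OF h that] that B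
      integrable_subinterval_real[OF h, of u v] by simp
  show ?thesis
    using *[of s t] *[of t s] st by (cases "s \<le> t") (auto simp: abs_minus_commute)
qed

text \<open>The library provides right derivatives almost everywhere; left derivatives come from
  reflecting the integrand.\<close>
lemma indefinite_integral_has_derivative_ae:
  fixes h :: "real \<Rightarrow> real"
  assumes h: "h integrable_on {a..b}"
  obtains N where "negligible N"
    "\<And>t. t \<in> {a..b} - N \<Longrightarrow>
       ((\<lambda>t. integral {a..t} h) has_real_derivative h t) (at t within {a..b})"
proof -
  \<comment> \<open>Extension by zero gives integrability on every bounded interval, as the
    differentiation theorem requires for \<open>g\<close> and for its reflection.\<close>
  define g where "g = (\<lambda>x. if x \<in> {a..b} then h x else 0)"
  have g: "g integrable_on {c..d}" for c d
  proof -
    have "g integrable_on UNIV" using h unfolding g_def by (subst integrable_restrict_UNIV)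
    then show ?thesis using integrable_on_subcbox[of g UNIV c d] by (simp add: cbox_interval)
  qed
  have g': "(\<lambda>x. g (- x)) integrable_on {c..d}" for c d
    using g[of "- d" "- c"] Henstock_Kurzweil_Integration.integrable_reflect_real[where f = g and a = "- d" and b = "- c"] by simp
  obtain N1 where N1: "negligible N1" "\<And>x e. \<lbrakk>x \<notin> N1; 0 < e\<rbrakk> \<Longrightarrow> \<exists>d>0. \<forall>k. 0 < k \<and> k < d \<longrightarrow>
      \<bar>integral {x..x + k} g / k - g x\<bar> < e"
    using integrable_ccontinuous_explicit[of g] g by (auto simp: divide_inverse mult.commute)
  obtain N2 where N2: "negligible N2" "\<And>x e. \<lbrakk>x \<notin> N2; 0 < e\<rbrakk> \<Longrightarrow> \<exists>d>0. \<forall>k. 0 < k \<and> k < d \<longrightarrow>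
      \<bar>integral {x..x + k} (\<lambda>x. g (- x)) / k - g (- x)\<bar> < e"
    using integrable_ccontinuous_explicit[of "\<lambda>x. g (- x)"] g' by (auto simp: divide_inverse mult.commute)
  \<comment> \<open>The points of \<open>N2\<close> are exceptional for the reflected function, so
    its mirror image is what has to be removed.\<close>
  define N where "N = N1 \<union> uminus ` N2"
  have "negligible N"
    unfolding N_def using N1(1) N2(1)
    by (intro negligible_Un negligible_differentiable_image_negligible)
      (auto intro!: derivative_intros differentiable_on_minus differentiable_on_id)
  moreover have "((\<lambda>t. integral {a..t} h) has_real_derivative h t) (at t within {a..b})"
    if t: "t \<in> {a..b} - N" for t
    unfolding has_field_derivative_iff Lim_within
  proof (intro allI impI)
    fix e :: real assume e: "e > 0"
    have "t \<notin> N1" "- t \<notin> N2" using t by (auto simp: N_def image_iff)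
    obtain d1 where d1: "d1 > 0" "\<And>k. \<lbrakk>0 < k; k < d1\<rbrakk> \<Longrightarrow> \<bar>integral {t..t + k} g / k - g t\<bar> < e"
      using N1(2)[OF \<open>t \<notin> N1\<close> e] by blast
    obtain d2 where d2: "d2 > 0" "\<And>k. \<lbrakk>0 < k; k < d2\<rbrakk> \<Longrightarrow>
        \<bar>integral {- t..- t + k} (\<lambda>x. g (- x)) / k - g t\<bar> < e"
      using N2(2)[OF \<open>- t \<notin> N2\<close> e] by auto
    have gh: "integral {u..v} g = integral {u..v} h" if "a \<le> u" "v \<le> b" for u v
      using that by (intro Henstock_Kurzweil_Integration.integral_cong) (auto simp: g_def)
    have gt: "g t = h t" using t by (simp add: g_def)
    have "dist ((integral {a..y} h - integral {a..t} h) / (y - t)) (h t) < e"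
      if y: "y \<in> {a..b}" "0 < dist y t" "dist y t < min d1 d2" for y
    proof (cases "t < y")
      case True
      have "integral {a..y} h - integral {a..t} h = integral {t..y} g"
        using indefinite_integral_diff[OF h, of t y] gh[of t y] t y True by simp
      then show ?thesis
        using d1(2)[of "y - t"] True y gt by (simp add: dist_real_def)
    next
      case False
      then have yt: "y < t" using y by auto
      have "integral {a..t} h - integral {a..y} h = integral {y..t} g"
        using indefinite_integral_diff[OF h, of y t] gh[of y t] t y yt by simp
      also have "\<dots> = integral {- t..- t + (t - y)} (\<lambda>x. g (- x))"
        using Henstock_Kurzweil_Integration.integral_reflect_real[of t y g] by simp
      finally have *: "integral {a..t} h - integral {a..y} h
          = integral {- t..- t + (t - y)} (\<lambda>x. g (- x))" .
      have "(integral {a..y} h - integral {a..t} h) / (y - t)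
          = (integral {a..t} h - integral {a..y} h) / (t - y)"
        by (metis minus_diff_eq minus_divide_divide)
      then show ?thesis
        using d2(2)[of "t - y"] yt y gt * by (simp add: dist_real_def)
    qed
    then show "\<exists>d>0. \<forall>y\<in>{a..b}. 0 < dist y t \<and> dist y t < d \<longrightarrow>
        dist ((integral {a..y} h - integral {a..t} h) / (y - t)) (h t) < e"
      using d1 d2 by (intro exI[of _ "min d1 d2"]) auto
  qed
  ultimately show thesis using that by blast
qed

text \<open>The product is Lebesgue measurable, since an integrable function is, and it is dominated
  by the continuous function \<open>\<bar>g s\<bar> * B\<close>.\<close>

lemma integrable_bounded_times_continuous:
  fixes g h :: "real \<Rightarrow> real"
  assumes h: "h integrable_on {a..b}" and B: "\<And>s. s \<in> {a..b} \<Longrightarrow> \<bar>h s\<bar> \<le> B"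
    and g: "continuous_on {a..b} g"
  shows "(\<lambda>s. g s * h s) integrable_on {a..b}"
proof (rule measurable_bounded_by_integrable_imp_integrable_real)
  show "(\<lambda>s. g s * h s) \<in> borel_measurable (lebesgue_on {a..b})"
    using h g by (intro borel_measurable_times integrable_imp_measurable
        continuous_imp_measurable_on_sets_lebesgue) auto
  show "(\<lambda>s. \<bar>g s\<bar> * B) integrable_on {a..b}"
    using g by (intro integrable_continuous_real continuous_intros)
  show "\<bar>g s * h s\<bar> \<le> \<bar>g s\<bar> * B" if "s \<in> {a..b}" for s
    using B[OF that] by (simp add: abs_mult mult_left_mono)
qed auto

section \<open>The twice iterated integral\<close>

text \<open>Cauchy's formula: the integral of \<open>(t - s) * h s\<close> over
  \<open>[a,t]\<close>, expanded so that neither integrand depends on \<open>t\<close>.\<close>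

definition iterated_integral :: "real \<Rightarrow> (real \<Rightarrow> real) \<Rightarrow> real \<Rightarrow> real" where
  "iterated_integral a h t = t * integral {a..t} h - integral {a..t} (\<lambda>s. s * h s)"

lemma iterated_integral_left [simp]: "iterated_integral a h a = 0"
  by (simp add: iterated_integral_def)

lemma iterated_integral_has_derivative:
  fixes h :: "real \<Rightarrow> real"
  assumes h: "h integrable_on {a..b}" and B: "\<And>s. s \<in> {a..b} \<Longrightarrow> \<bar>h s\<bar> \<le> B"
    and t: "t \<in> {a..b}"
  shows "(iterated_integral a h has_real_derivative integral {a..t} h) (at t within {a..b})"
proof -
  have sh: "(\<lambda>s. s * h s) integrable_on {a..b}"
    by (rule integrable_bounded_times_continuous[OF h B]) (auto intro: continuous_intros)
  \<comment> \<open>The point \<open>w\<close> plays the role of \<open>y\<close>: it is the right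
    end of the piece if \<open>t \<le> y\<close> and the left end otherwise.\<close>
  have bound: "\<bar>w * integral {u..v} h - integral {u..v} (\<lambda>s. s * h s)\<bar> \<le> B * (v - u) * (v - u)"
    if uv: "a \<le> u" "u \<le> w" "w \<le> v" "v \<le> b" for u v w
  proof -
    have hu: "h integrable_on {u..v}" "(\<lambda>s. s * h s) integrable_on {u..v}"
      using integrable_subinterval_real[OF h, of u v] integrable_subinterval_real[OF sh, of u v] uv
      by auto
    have "w * integral {u..v} h - integral {u..v} (\<lambda>s. s * h s)
        = integral {u..v} (\<lambda>s. w * h s - s * h s)"
      using hu by (simp add: Henstock_Kurzweil_Integration.integral_diff integrable_on_mult_right)
    also have "\<bar>\<dots>\<bar> \<le> B * (v - u) * (v - u)"
    proof (rule abs_integral_le_const)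
      show "(\<lambda>s. w * h s - s * h s) integrable_on {u..v}"
        using hu by (intro integrable_diff integrable_on_mult_right)
      fix s assume s: "s \<in> {u..v}"
      have "\<bar>w * h s - s * h s\<bar> = \<bar>h s\<bar> * \<bar>w - s\<bar>"
        by (simp add: abs_mult[symmetric] algebra_simps)
      also have "\<dots> \<le> B * (v - u)"
        using B[of s] s uv by (intro mult_mono) auto
      finally show "\<bar>w * h s - s * h s\<bar> \<le> B * (v - u)" .
    qed (use uv in auto)
    finally show ?thesis .
  qed
  have est: "\<bar>iterated_integral a h y - iterated_integral a h t - integral {a..t} h * (y - t)\<bar>
      \<le> B * \<bar>y - t\<bar> * \<bar>y - t\<bar>" if y: "y \<in> {a..b}" for y
  proof (cases "t \<le> y")
    case True
    have *: "integral {a..y} h = integral {a..t} h + integral {t..y} h"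
      "integral {a..y} (\<lambda>s. s * h s) = integral {a..t} (\<lambda>s. s * h s) + integral {t..y} (\<lambda>s. s * h s)"
      using indefinite_integral_diff[OF h, of t y] indefinite_integral_diff[OF sh, of t y] t y True by auto
    have "iterated_integral a h y - iterated_integral a h t - integral {a..t} h * (y - t)
        = y * integral {t..y} h - integral {t..y} (\<lambda>s. s * h s)"
      unfolding iterated_integral_def * by (simp add: algebra_simps)
    then show ?thesis using bound[of t y y] t y True by simp
  next
    case False
    have *: "integral {a..t} h = integral {a..y} h + integral {y..t} h"
      "integral {a..t} (\<lambda>s. s * h s) = integral {a..y} (\<lambda>s. s * h s) + integral {y..t} (\<lambda>s. s * h s)"
      using indefinite_integral_diff[OF h, of y t] indefinite_integral_diff[OF sh, of y t] t y False by auto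
    have "iterated_integral a h y - iterated_integral a h t - integral {a..t} h * (y - t)
        = - (y * integral {y..t} h - integral {y..t} (\<lambda>s. s * h s))"
      unfolding iterated_integral_def * by (simp add: algebra_simps)
    then show ?thesis using bound[of y y t] t y False by simp
  qed
  show ?thesis
    unfolding has_field_derivative_def has_derivative_within_alt
  proof (intro conjI allI impI)
    fix e :: real assume "e > 0"
    \<comment> \<open>The radius \<open>e / (\<bar>B\<bar> + 1)\<close> absorbs one factor of the
      quadratic remainder into \<open>e\<close>.\<close>
    have "\<bar>iterated_integral a h y - iterated_integral a h t - integral {a..t} h * (y - t)\<bar>
        \<le> e * \<bar>y - t\<bar>" if y: "y \<in> {a..b}" "\<bar>y - t\<bar> < e / (\<bar>B\<bar> + 1)" for y
    proof -
      have "B * \<bar>y - t\<bar> \<le> (\<bar>B\<bar> + 1) * \<bar>y - t\<bar>" by (intro mult_right_mono) auto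
      also have "\<dots> \<le> e" using y(2) by (simp add: field_simps)
      finally have "B * \<bar>y - t\<bar> * \<bar>y - t\<bar> \<le> e * \<bar>y - t\<bar>" by (intro mult_right_mono) auto
      then show ?thesis using est[OF y(1)] by simp
    qed
    then show "\<exists>d>0. \<forall>y\<in>{a..b}. norm (y - t) < d \<longrightarrow>
        norm (iterated_integral a h y - iterated_integral a h t - integral {a..t} h * (y - t))
        \<le> e * norm (y - t)"
      using \<open>e > 0\<close> by (intro exI[of _ "e / (\<bar>B\<bar> + 1)"]) auto
  qed (rule bounded_linear_mult_right)
qed

section \<open>The Green kernel\<close>

text \<open>Both branches agree on the diagonal. The form with \<open>min\<close> and
  \<open>max\<close> makes continuity across it evident.\<close>

lemma green_eq: "green a b t s = - ((min s t - a) * (b - max s t) / (b - a))"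
  by (simp add: green_def min_def max_def)

lemma continuous_on_green: "a < b \<Longrightarrow> continuous_on S (green a b t)"
  unfolding green_eq[abs_def] by (intro continuous_intros) auto

lemma green_neg:
  assumes "a < s" "s < b" "a < t" "t < b"
  shows "green a b t s < 0"
  using assms by (auto simp: green_def intro!: divide_pos_pos mult_pos_pos)

text \<open>That \<open>T\<close> is defined gives integrability only of products with the kernel.
  For \<open>t\<close> the midpoint the kernel is continuous and negative on the open interval, so
  division recovers measurability of \<open>h\<close> there, and boundedness gives integrability.
  The endpoints, where the kernel vanishes, form a null set.\<close>

lemma integrable_of_green_integrable:
  fixes h :: "real \<Rightarrow> real"
  assumes "a < b" and gh: "(\<lambda>s. green a b ((a + b) / 2) s * h s) integrable_on {a..b}"
    and B: "\<And>s. s \<in> {a..b} \<Longrightarrow> \<bar>h s\<bar> \<le> B"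
  shows "h integrable_on {a..b}"
proof -
  let ?g = "green a b ((a + b) / 2)"
  have "(\<lambda>s. ?g s * h s) integrable_on {a<..<b}"
    using gh by (simp add: integrable_on_Icc_iff_Ioo)
  then have "(\<lambda>s. (?g s * h s) / ?g s) \<in> borel_measurable (lebesgue_on {a<..<b})"
    using continuous_on_green[OF \<open>a < b\<close>]
    by (intro borel_measurable_divide integrable_imp_measurable
        continuous_imp_measurable_on_sets_lebesgue) auto
  moreover have "?g s \<noteq> 0" if "s \<in> {a<..<b}" for s
    using green_neg[of a s b "(a + b) / 2"] that \<open>a < b\<close> by auto
  ultimately have "h \<in> borel_measurable (lebesgue_on {a<..<b})"
    by (subst measurable_cong[where g = "\<lambda>s. (?g s * h s) / ?g s"]) auto
  moreover have "(\<lambda>_. B) integrable_on {a<..<b}"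
    using integrable_on_Icc_iff_Ioo[of "\<lambda>_. B" a b] by (simp add: integrable_const_ivl)
  ultimately have "h integrable_on {a<..<b}"
    using B by (intro measurable_bounded_by_integrable_imp_integrable_real[of h _ "\<lambda>_. B"]) auto
  then show ?thesis by (simp add: integrable_on_Icc_iff_Ioo)
qed

text \<open>The right side is the iterated integral, corrected by an affine function so as to vanish
  at \<open>a\<close> and \<open>b\<close>. On either side of \<open>t\<close> the kernel is affine
  in \<open>s\<close>, so everything reduces to the integrals of \<open>h s\<close> and
  \<open>s * h s\<close> over the two pieces.\<close>

lemma integral_green_times:
  fixes h :: "real \<Rightarrow> real"
  assumes "a < b" and h: "h integrable_on {a..b}" and B: "\<And>s. s \<in> {a..b} \<Longrightarrow> \<bar>h s\<bar> \<le> B"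
    and t: "t \<in> {a..b}"
  shows "integral {a..b} (\<lambda>s. green a b t s * h s)
    = iterated_integral a h t - (t - a) / (b - a) * iterated_integral a h b"
proof -
  have sh: "(\<lambda>s. s * h s) integrable_on {a..b}"
    by (rule integrable_bounded_times_continuous[OF h B]) (auto intro: continuous_intros)
  define H1 P1 H2 P2 where "H1 = integral {a..t} h" and "P1 = integral {a..t} (\<lambda>s. s * h s)"
    and "H2 = integral {t..b} h" and "P2 = integral {t..b} (\<lambda>s. s * h s)"
  have i: "(h has_integral H1) {a..t}" "((\<lambda>s. s * h s) has_integral P1) {a..t}"
      "(h has_integral H2) {t..b}" "((\<lambda>s. s * h s) has_integral P2) {t..b}"
    using t unfolding H1_def P1_def H2_def P2_def
    by (auto intro!: integrable_integral intro: integrable_subinterval_real[OF h] integrable_subinterval_real[OF sh])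
  \<comment> \<open>These are the barycentric weights of \<open>t\<close> with respect to
    \<open>a\<close> and \<open>b\<close>; with them the rest is polynomial algebra.\<close>
  define k m where "k = (b - t) / (b - a)" and "m = (t - a) / (b - a)"
  have k: "k = 1 - m" and t_km: "t = a * k + b * m"
    
  proof -
    show k: "k = 1 - m" using \<open>a < b\<close> by (simp add: k_def m_def field_simps)
    have "m * (b - a) = t - a" using \<open>a < b\<close> by (simp add: m_def)
    then show "t = a * k + b * m" unfolding k by (simp add: algebra_simps)
  qed
  have "((\<lambda>s. (a * k) * h s - k * (s * h s)) has_integral (a * k) * H1 - k * P1) {a..t}"
    by (intro has_integral_diff has_integral_mult_right i)
  then have 1: "((\<lambda>s. green a b t s * h s) has_integral (a * k) * H1 - k * P1) {a..t}"
  proof (rule has_integral_eq[rotated])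
    fix s assume "s \<in> {a..t}"
    then have g: "green a b t s = - ((s - a) * k)" by (simp add: green_def k_def)
    show "(a * k) * h s - k * (s * h s) = green a b t s * h s"
      unfolding g by (simp add: algebra_simps)
  qed
  have "((\<lambda>s. m * (s * h s) - (b * m) * h s) has_integral m * P2 - (b * m) * H2) {t..b}"
    by (intro has_integral_diff has_integral_mult_right i)
  then have 2: "((\<lambda>s. green a b t s * h s) has_integral m * P2 - (b * m) * H2) {t..b}"
  proof (rule has_integral_eq[rotated])
    fix s assume "s \<in> {t..b}"
    then have g: "green a b t s = - (m * (b - s))" by (simp add: green_eq m_def)
    show "m * (s * h s) - (b * m) * h s = green a b t s * h s"
      unfolding g by (simp add: algebra_simps)
  qed
  have "integral {a..b} (\<lambda>s. green a b t s * h s)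
      = (a * k) * H1 - k * P1 + (m * P2 - (b * m) * H2)"
    using has_integral_combine[OF _ _ 1 2] t by (auto intro: integral_unique)
  \<comment> \<open>Adding and subtracting \<open>b * m * H1\<close> and replacing \<open>k\<close>
    by \<open>1 - m\<close> groups the terms into the iterated integrals at \<open>t\<close> and at
    \<open>b\<close>.\<close>
  also have "\<dots> = (a * k + b * m) * H1 - P1 - m * (b * (H1 + H2) - (P1 + P2))"
    unfolding k by (simp add: algebra_simps)
  also have "\<dots> = (t * H1 - P1) - (t - a) / (b - a) * (b * (H1 + H2) - (P1 + P2))"
    using t_km m_def by simp
  also have "\<dots> = iterated_integral a h t - (t - a) / (b - a) * iterated_integral a h b"
    using Henstock_Kurzweil_Integration.integral_combine[OF _ _ h, of t]
      Henstock_Kurzweil_Integration.integral_combine[OF _ _ sh, of t] t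
    by (simp add: iterated_integral_def H1_def H2_def P1_def P2_def)
  finally show ?thesis .
qed

lemma abs_integral_green_le:
  fixes h :: "real \<Rightarrow> real"
  assumes "a < b" "(\<lambda>s. green a b t s * h s) integrable_on {a..b}"
    and "\<And>s. s \<in> {a..b} \<Longrightarrow> \<bar>h s\<bar> \<le> B"
  shows "\<bar>integral {a..b} (\<lambda>s. green a b t s * h s)\<bar> \<le> integral {a..b} (\<lambda>s. \<bar>green a b t s\<bar>) * B"
proof -
  have "(\<lambda>s. \<bar>green a b t s\<bar> * B) integrable_on {a..b}"
    using continuous_on_green[OF \<open>a < b\<close>] by (intro integrable_continuous_real continuous_intros)
  then have "\<bar>integral {a..b} (\<lambda>s. green a b t s * h s)\<bar> \<le> integral {a..b} (\<lambda>s. \<bar>green a b t s\<bar> * B)"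
    using integral_norm_bound_integral[OF assms(2), of "\<lambda>s. \<bar>green a b t s\<bar> * B"] assms(3)
    by (simp add: abs_mult mult_left_mono)
  then show ?thesis by simp
qed

section \<open>Solutions as fixed points\<close>

lemma dirichlet_op_eq:
  assumes "a < b" "(\<lambda>s. F s (x s)) integrable_on {a..b}"
    and "\<And>s. s \<in> {a..b} \<Longrightarrow> \<bar>F s (x s)\<bar> \<le> B" "t \<in> {a..b}"
  shows "dirichlet_op a b \<alpha> \<beta> F x t = affine_interp a b \<alpha> \<beta> t
    + (iterated_integral a (\<lambda>s. F s (x s)) t - (t - a) / (b - a) * iterated_integral a (\<lambda>s. F s (x s)) b)"
  using assms integral_green_times[OF assms] by (simp add: dirichlet_op_def)

text \<open>Differentiates the representation by the iterated integral, at every point and without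
  continuity of the integrand. Continuity of \<open>dirichlet_op a b \<alpha> \<beta> F x\<close> on
  \<open>[a,b]\<close> follows as well.\<close>

lemma dirichlet_op_has_derivative:
  assumes "a < b" and h: "(\<lambda>s. F s (x s)) integrable_on {a..b}"
    and B: "\<And>s. s \<in> {a..b} \<Longrightarrow> \<bar>F s (x s)\<bar> \<le> B" and t: "t \<in> {a..b}"
  shows "(dirichlet_op a b \<alpha> \<beta> F x has_real_derivative
    integral {a..t} (\<lambda>s. F s (x s)) + (\<beta> - \<alpha> - iterated_integral a (\<lambda>s. F s (x s)) b) / (b - a))
    (at t within {a..b})"
proof -
  let ?K = "iterated_integral a (\<lambda>s. F s (x s))"
  have "((\<lambda>u. affine_interp a b \<alpha> \<beta> u) has_real_derivative (\<beta> - \<alpha>) / (b - a)) (at t within {a..b})"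
    unfolding affine_interp_def using \<open>a < b\<close> by (auto intro!: derivative_eq_intros)
  moreover have "((\<lambda>u. (u - a) / (b - a) * ?K b) has_real_derivative ?K b / (b - a)) (at t within {a..b})"
    using \<open>a < b\<close> by (auto intro!: derivative_eq_intros)
  ultimately have "((\<lambda>u. affine_interp a b \<alpha> \<beta> u + (?K u - (u - a) / (b - a) * ?K b)) has_real_derivative
      (\<beta> - \<alpha>) / (b - a) + (integral {a..t} (\<lambda>s. F s (x s)) - ?K b / (b - a))) (at t within {a..b})"
    by (intro DERIV_add DERIV_diff iterated_integral_has_derivative[OF h B t])
  from has_derivative_transform[OF t dirichlet_op_eq[where F = F, OF assms(1-3)]
      this[unfolded has_field_derivative_def]]
  show ?thesis by (simp add: has_field_derivative_def diff_divide_distrib add_divide_distrib algebra_simps)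
qed

lemma dirichlet_op_boundary:
  assumes "a < b" "(\<lambda>s. F s (x s)) integrable_on {a..b}"
    and "\<And>s. s \<in> {a..b} \<Longrightarrow> \<bar>F s (x s)\<bar> \<le> B"
  shows "dirichlet_op a b \<alpha> \<beta> F x a = \<alpha>" "dirichlet_op a b \<alpha> \<beta> F x b = \<beta>"
  using dirichlet_op_eq[where F = F, OF assms] \<open>a < b\<close> by (simp_all add: affine_interp_def)

text \<open>The derivative of a fixed point is a constant plus an indefinite integral of a bounded
  function. It is therefore Lipschitz, and differentiable almost everywhere with the integrand as
  derivative.\<close>

lemma fixed_point_imp_caratheodory:
  assumes "a < b" and h: "(\<lambda>s. F s (x s)) integrable_on {a..b}"
    and B: "\<And>s. s \<in> {a..b} \<Longrightarrow> \<bar>F s (x s)\<bar> \<le> B"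
    and fp: "dirichlet_op a b \<alpha> \<beta> F x = x"
  shows "caratheodory_solution a b \<alpha> \<beta> F x"
proof -
  let ?h = "\<lambda>s. F s (x s)"
  define c where "c = (\<beta> - \<alpha> - iterated_integral a ?h b) / (b - a)"
  define y where "y = (\<lambda>t. integral {a..t} ?h + c)"
  have "\<forall>t\<in>{a..b}. (x has_real_derivative y t) (at t within {a..b})"
    using dirichlet_op_has_derivative[where F = F, OF assms(1-3), of _ \<alpha> \<beta>] fp by (simp add: y_def c_def)
  moreover have "abs_continuous a b y"
    using indefinite_integral_lipschitz[OF h B] by (intro abs_continuous_lipschitz) (simp add: y_def)
  moreover obtain N where N: "negligible N" "\<And>t. t \<in> {a..b} - N \<Longrightarrow>
      ((\<lambda>t. integral {a..t} ?h) has_real_derivative ?h t) (at t within {a..b})"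
    using indefinite_integral_has_derivative_ae[OF h] by blast
  have "AE t in lebesgue. t \<in> {a..b} \<longrightarrow> (y has_real_derivative F t (x t)) (at t within {a..b})"
    unfolding eventually_ae_filter_negligible
  proof (intro exI[of _ N] conjI N(1) subsetI, rule ccontr, clarsimp)
    fix t assume t: "t \<notin> N" "a \<le> t" "t \<le> b"
      and *: "\<not> (y has_real_derivative F t (x t)) (at t within {a..b})"
    have "(y has_real_derivative F t (x t) + 0) (at t within {a..b})"
      unfolding y_def using t by (intro DERIV_add N(2) DERIV_const) auto
    then show False using * by simp
  qed
  ultimately show ?thesis
    using dirichlet_op_boundary[where F = F, OF assms(1-3), of \<alpha> \<beta>] fp
    unfolding caratheodory_solution_def by metis
qed

text \<open>For a continuous integrand the fundamental theorem of calculus gives the second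
  derivative at every point.\<close>

lemma fixed_point_imp_classical:
  assumes "a < b" and h: "continuous_on {a..b} (\<lambda>s. F s (x s))"
    and B: "\<And>s. s \<in> {a..b} \<Longrightarrow> \<bar>F s (x s)\<bar> \<le> B"
    and fp: "dirichlet_op a b \<alpha> \<beta> F x = x"
  shows "classical_solution a b \<alpha> \<beta> F x"
proof -
  let ?h = "\<lambda>s. F s (x s)"
  have hi: "?h integrable_on {a..b}" using h by (rule integrable_continuous_real)
  define c where "c = (\<beta> - \<alpha> - iterated_integral a ?h b) / (b - a)"
  define y where "y = (\<lambda>t. integral {a..t} ?h + c)"
  have "\<forall>t\<in>{a..b}. (x has_real_derivative y t) (at t within {a..b})"
    using dirichlet_op_has_derivative[where F = F, OF assms(1) hi B, of _ \<alpha> \<beta>] fp by (simp add: y_def c_def)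
  moreover have "\<forall>t\<in>{a..b}. (y has_real_derivative ?h t) (at t within {a..b})"
    unfolding y_def
    by (auto intro!: derivative_eq_intros integral_has_real_derivative[OF h])
  ultimately show ?thesis
    using dirichlet_op_boundary[where F = F, OF assms(1) hi B, of \<alpha> \<beta>] fp
    unfolding classical_solution_def by metis
qed

text \<open>The derivative \<open>y\<close> and the indefinite integral of the right-hand side are
  absolutely continuous with equal derivatives almost everywhere, so they differ by
  \<open>y a\<close>. A second integration determines \<open>x\<close> up to this slope, and the
  boundary value at \<open>b\<close> fixes the slope to the one in the formula for the
  operator.\<close>

lemma caratheodory_imp_fixed_point:
  assumes "a < b" and h: "(\<lambda>s. F s (x s)) integrable_on {a..b}"
    and B: "\<And>s. s \<in> {a..b} \<Longrightarrow> \<bar>F s (x s)\<bar> \<le> B"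
    and ext: "x \<in> extensional {a..b}" and sol: "caratheodory_solution a b \<alpha> \<beta> F x"
  shows "dirichlet_op a b \<alpha> \<beta> F x = x"
proof -
  let ?h = "\<lambda>s. F s (x s)"
  let ?K = "iterated_integral a ?h"
  obtain y where y: "\<And>t. t \<in> {a..b} \<Longrightarrow> (x has_real_derivative y t) (at t within {a..b})"
    and ac: "abs_continuous a b y"
    and ae: "AE t in lebesgue. t \<in> {a..b} \<longrightarrow> (y has_real_derivative ?h t) (at t within {a..b})"
    and bd: "x a = \<alpha>" "x b = \<beta>"
    using sol unfolding caratheodory_solution_def by metis
  obtain N where N: "negligible N" "\<And>t. t \<in> {a..b} - N \<Longrightarrow>
      ((\<lambda>t. integral {a..t} ?h) has_real_derivative ?h t) (at t within {a..b})"
    using indefinite_integral_has_derivative_ae[OF h] by blast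
  obtain N' where N': "negligible N'" "\<And>t. t \<in> {a..b} - N' \<Longrightarrow>
      (y has_real_derivative ?h t) (at t within {a..b})"
    using ae unfolding eventually_ae_filter_negligible by auto
  have "abs_continuous a b (\<lambda>t. integral {a..t} ?h)"
    by (rule abs_continuous_lipschitz[OF indefinite_integral_lipschitz[OF h B]])
  then have ac': "abs_continuous a b (\<lambda>t. y t - integral {a..t} ?h)"
    by (rule abs_continuous_diff[OF ac])
  have yH: "y t = y a + integral {a..t} ?h" if t: "t \<in> {a..b}" for t
  proof -
    have "((\<lambda>t. y t - integral {a..t} ?h) has_real_derivative 0) (at s within {a..b})"
      if "s \<in> {a..b} - (N \<union> N')" for s
      using DERIV_diff[OF N'(2)[of s] N(2)[of s]] that by simp
    then have "y t - integral {a..t} ?h = y a - integral {a..a} ?h"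
      using abs_continuous_zero_derivative_const[OF ac' negligible_Un[OF N(1) N'(1)]] t by blast
    then show ?thesis by simp
  qed
  \<comment> \<open>Here the derivative vanishes at every point of \<open>[a,b]\<close>, so
    constancy follows from the elementary theorem.\<close>
  define w where "w = (\<lambda>t. x t - ?K t - y a * (t - a))"
  have "(w has_real_derivative 0) (at t within {a..b})" if t: "t \<in> {a..b}" for t
  proof -
    have "((\<lambda>t. y a * (t - a)) has_real_derivative y a) (at t within {a..b})"
      by (auto intro!: derivative_eq_intros)
    from DERIV_diff[OF DERIV_diff[OF y[OF t] iterated_integral_has_derivative[OF h B t]] this]
    show ?thesis by (simp add: w_def yH[OF t])
  qed
  then have "w t = w a" if "t \<in> {a..b}" for t
    using has_field_derivative_zero_constant[of "{a..b}" w] that \<open>a < b\<close> by force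
  then have x: "x t = \<alpha> + ?K t + y a * (t - a)" if "t \<in> {a..b}" for t
    using that bd by (fastforce simp: w_def)
  have "\<beta> = \<alpha> + ?K b + y a * (b - a)" using x[of b] bd \<open>a < b\<close> by simp
  then have ya: "y a = (\<beta> - \<alpha> - ?K b) / (b - a)" using \<open>a < b\<close> by (simp add: field_simps)
  show ?thesis
  proof (rule extensionalityI[OF _ ext])
    show "dirichlet_op a b \<alpha> \<beta> F x \<in> extensional {a..b}" by (simp add: dirichlet_op_def)
    fix t assume t: "t \<in> {a..b}"
    have "dirichlet_op a b \<alpha> \<beta> F x t
        = affine_interp a b \<alpha> \<beta> t + (?K t - (t - a) / (b - a) * ?K b)"
      by (rule dirichlet_op_eq[where F = F, OF assms(1-3) t])
    also have "\<dots> = \<alpha> + ?K t + y a * (t - a)"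
      unfolding ya affine_interp_def
      by (simp add: add_divide_distrib diff_divide_distrib algebra_simps)
    finally show "dirichlet_op a b \<alpha> \<beta> F x t = x t" using x[OF t] by simp
  qed
qed

text \<open>The second derivative may be discontinuous but is bounded by \<open>B\<close>, so the
  mean value inequality makes the first derivative Lipschitz.\<close>

lemma classical_imp_caratheodory:
  assumes B: "\<And>s. s \<in> {a..b} \<Longrightarrow> \<bar>F s (x s)\<bar> \<le> B" and sol: "classical_solution a b \<alpha> \<beta> F x"
  shows "caratheodory_solution a b \<alpha> \<beta> F x"
proof -
  obtain y where y: "\<forall>t\<in>{a..b}. (x has_real_derivative y t) (at t within {a..b})"
      "\<forall>t\<in>{a..b}. (y has_real_derivative F t (x t)) (at t within {a..b})" "x a = \<alpha>" "x b = \<beta>"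
    using sol unfolding classical_solution_def by metis
  have "abs_continuous a b y"
  proof (rule abs_continuous_lipschitz)
    fix s t assume "s \<in> {a..b}" "t \<in> {a..b}"
    then show "\<bar>y t - y s\<bar> \<le> B * \<bar>t - s\<bar>"
      using field_differentiable_bound[of "{a..b}" y "\<lambda>t. F t (x t)" B] y(2) B by simp
  qed
  then show ?thesis using y unfolding caratheodory_solution_def by (intro conjI exI[of _ y]) auto
qed

section \<open>The space of continuous functions\<close>

lemma restrict_in_cont_space:
  "continuous_on {a..b} x \<Longrightarrow> restrict x {a..b} \<in> cont_space a b"
  by (auto simp: cont_space_def elim: continuous_on_eq)

lemma abs_le_sup_norm:
  assumes "continuous_on {a..b} x" "t \<in> {a..b}"
  shows "\<bar>x t\<bar> \<le> sup_norm a b x"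
proof -
  have "compact ((\<lambda>t. \<bar>x t\<bar>) ` {a..b})"
    using assms by (intro compact_continuous_image continuous_intros) auto
  then show ?thesis
    unfolding sup_norm_def using assms(2)
    by (intro cSUP_upper bounded_imp_bdd_above compact_imp_bounded)
qed

lemma sup_norm_le:
  assumes "a \<le> b" "\<And>t. t \<in> {a..b} \<Longrightarrow> \<bar>x t\<bar> \<le> B"
  shows "sup_norm a b x \<le> B"
  unfolding sup_norm_def using assms by (intro cSUP_least) auto

lemma sup_norm_nonneg:
  assumes "a \<le> b" "continuous_on {a..b} x"
  shows "0 \<le> sup_norm a b x"
  using abs_le_sup_norm[OF assms(2), of a] assms(1) by simp

text \<open>The metric is cut off outside the space because the supremum of an unbounded set is
  unspecified.\<close>
lemma cont_space_contraction_fixed_point: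
  assumes "a \<le> b" and T: "T \<in> cont_space a b \<rightarrow> cont_space a b" and "k < 1"
    and contr: "\<And>x y. \<lbrakk>x \<in> cont_space a b; y \<in> cont_space a b\<rbrakk> \<Longrightarrow>
      sup_norm a b (\<lambda>t. T x t - T y t) \<le> k * sup_norm a b (\<lambda>t. x t - y t)"
  obtains x where "x \<in> cont_space a b" "T x = x"
proof -
  let ?X = "cont_space a b"
  define d where "d = (\<lambda>x y. if x \<in> ?X \<and> y \<in> ?X then sup_norm a b (\<lambda>t. x t - y t) else 0)"
  have cont: "continuous_on {a..b} (\<lambda>t. x t - y t)" if "x \<in> ?X" "y \<in> ?X" for x y
    using that by (auto simp: cont_space_def intro: continuous_intros)
  have d_ge: "\<bar>x t - y t\<bar> \<le> d x y" if "x \<in> ?X" "y \<in> ?X" "t \<in> {a..b}" for x y t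
    using abs_le_sup_norm[OF cont that(3)] that by (simp add: d_def)
  have d_le: "d x y \<le> B" if "x \<in> ?X" "y \<in> ?X" "\<And>t. t \<in> {a..b} \<Longrightarrow> \<bar>x t - y t\<bar> \<le> B" for x y B
    using sup_norm_le[OF \<open>a \<le> b\<close> that(3)] that by (simp add: d_def)
  interpret Metric_space ?X d
  proof
    fix x y z
    show "0 \<le> d x y" using sup_norm_nonneg[OF \<open>a \<le> b\<close> cont] by (simp add: d_def)
    show "d x y = d y x" by (simp add: d_def sup_norm_def abs_minus_commute)
    show "d x y = 0 \<longleftrightarrow> x = y" if "x \<in> ?X" "y \<in> ?X"
    proof
      assume "d x y = 0"
      then have "x t = y t" if "t \<in> {a..b}" for t using d_ge[OF \<open>x \<in> ?X\<close> \<open>y \<in> ?X\<close> that] by simp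
      then show "x = y" using that by (auto simp: cont_space_def intro: extensionalityI)
    next
      assume "x = y"
      then show "d x y = 0" using \<open>a \<le> b\<close> by (simp add: d_def sup_norm_def)
    qed
    show "d x z \<le> d x y + d y z" if "x \<in> ?X" "y \<in> ?X" "z \<in> ?X"
    proof (rule d_le)
      show "\<bar>x t - z t\<bar> \<le> d x y + d y z" if "t \<in> {a..b}" for t
        using d_ge[of x y t] d_ge[of y z t] \<open>x \<in> ?X\<close> \<open>y \<in> ?X\<close> \<open>z \<in> ?X\<close> that by linarith
    qed (use that in auto)
  qed
  have "mcomplete"
    unfolding mcomplete_def
  proof (intro allI impI)
    fix \<sigma> :: "nat \<Rightarrow> real \<Rightarrow> real" assume \<sigma>: "MCauchy \<sigma>"
    then have \<sigma>X: "\<sigma> n \<in> ?X" for n by (auto simp: MCauchy_def)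
    have "uniformly_Cauchy_on {a..b} \<sigma>"
      unfolding uniformly_Cauchy_on_def
    proof (intro allI impI)
      fix e :: real assume "e > 0"
      then obtain N where "\<And>m n. \<lbrakk>N \<le> m; N \<le> n\<rbrakk> \<Longrightarrow> d (\<sigma> m) (\<sigma> n) < e"
        using \<sigma> unfolding MCauchy_def by meson
      then show "\<exists>M. \<forall>t\<in>{a..b}. \<forall>m\<ge>M. \<forall>n\<ge>M. dist (\<sigma> m t) (\<sigma> n t) < e"
        using d_ge[OF \<sigma>X \<sigma>X] unfolding dist_real_def by (meson le_less_trans)
    qed
    then obtain l where l: "uniform_limit {a..b} \<sigma> l sequentially"
      by (metis Cauchy_uniformly_convergent uniformly_convergent_on_def)
    have "continuous_on {a..b} l"
      using \<sigma>X by (intro uniform_limit_theorem[OF _ l]) (auto simp: cont_space_def)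
    \<comment> \<open>Off \<open>[a,b]\<close> the limit \<open>l\<close> is arbitrary; restriction
      puts it into the space and keeps its values on the interval.\<close>
    then have lX: "restrict l {a..b} \<in> ?X" by (rule restrict_in_cont_space)
    show "\<exists>x. limitin mtopology \<sigma> x sequentially"
      unfolding limit_metric_sequentially
    proof (rule exI[of _ "restrict l {a..b}"], intro conjI allI impI lX)
      fix e :: real assume "e > 0"
      \<comment> \<open>A strict pointwise bound passes to the supremum only as a non-strict one;
        halving \<open>e\<close> restores strictness.\<close>
      then have "\<exists>N. \<forall>n\<ge>N. \<forall>t\<in>{a..b}. \<bar>\<sigma> n t - l t\<bar> < e / 2"
        using uniform_limitD[OF l, of "e / 2"] by (simp add: eventually_sequentially dist_real_def)
      then obtain N where N: "\<And>n t. \<lbrakk>N \<le> n; t \<in> {a..b}\<rbrakk> \<Longrightarrow> \<bar>\<sigma> n t - l t\<bar> < e / 2"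
        by blast
      have "d (\<sigma> n) (restrict l {a..b}) < e" if "n \<ge> N" for n
      proof -
        have "d (\<sigma> n) (restrict l {a..b}) \<le> e / 2"
          using N[OF that] by (intro d_le \<sigma>X lX) (auto intro: less_imp_le)
        then show ?thesis using \<open>e > 0\<close> by simp
      qed
      then show "\<exists>N. \<forall>n\<ge>N. \<sigma> n \<in> ?X \<and> d (\<sigma> n) (restrict l {a..b}) < e"
        using \<sigma>X by blast
    qed
  qed
  moreover have "?X \<noteq> {}" using restrict_in_cont_space[OF continuous_on_const] by blast
  moreover have "d (T x) (T y) \<le> k * d x y" if "x \<in> ?X" "y \<in> ?X" for x y
    using contr[OF that] T that by (auto simp: d_def)
  ultimately show thesis
    using Banach_fixedpoint_thm[of T k] T \<open>k < 1\<close> that by blast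
qed

section \<open>Error bounds\<close>

text \<open>With \<open>e n\<close> the distance to the fixed point and \<delta> the length of the
  first step, \<open>e 0 \<le> \<delta> + e 1 \<le> \<delta> + L * e 0\<close> gives
  \<open>e 0 \<le> \<delta> / (1 - L)\<close>; contraction supplies the factor
  \<open>L ^ n\<close>.\<close>

lemma picard_error_bound:
  fixes e :: "nat \<Rightarrow> real"
  assumes "0 \<le> L" "L < 1" "\<And>n. e (Suc n) \<le> L * e n" "e 0 \<le> \<delta> + e 1"
  shows "e n \<le> L ^ n / (1 - L) * \<delta>"
proof -
  have "e n \<le> L ^ n * e 0"
  proof (induction n)
    case (Suc n)
    then show ?case using assms(3)[of n] mult_left_mono[OF Suc \<open>0 \<le> L\<close>] by simp
  qed simp
  also have "e 0 \<le> \<delta> / (1 - L)"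
    using assms(2,4) assms(3)[of 0] by (simp add: field_simps)
  then have "L ^ n * e 0 \<le> L ^ n * (\<delta> / (1 - L))"
    using \<open>0 \<le> L\<close> by (intro mult_left_mono) auto
  finally show ?thesis by simp
qed

text \<open>The \<open>LEAST\<close> is meaningful because the geometric bound tends to zero, so
  some index qualifies. Later indices qualify too, since the powers of \<open>L\<close>
  decrease.\<close>

lemma N_geo_bound:
  assumes "0 \<le> L" "L < 1" "0 \<le> \<delta>\<^sub>0" "0 < \<epsilon>" "N_geo \<epsilon> L \<delta>\<^sub>0 \<le> n"
  shows "L ^ n / (1 - L) * \<delta>\<^sub>0 \<le> \<epsilon>"
proof -
  let ?N = "N_geo \<epsilon> L \<delta>\<^sub>0"
  have "(\<lambda>n. L ^ n / (1 - L) * \<delta>\<^sub>0) \<longlonglongrightarrow> 0 / (1 - L) * \<delta>\<^sub>0"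
    using assms by (intro tendsto_intros LIMSEQ_realpow_zero) auto
  then have "eventually (\<lambda>n. L ^ n / (1 - L) * \<delta>\<^sub>0 < \<epsilon>) sequentially"
    using \<open>0 < \<epsilon>\<close> by (intro order_tendstoD(2)) auto
  then have "\<exists>n. L ^ n / (1 - L) * \<delta>\<^sub>0 \<le> \<epsilon>"
    unfolding eventually_sequentially by (meson less_imp_le order_refl)
  then have "L ^ ?N / (1 - L) * \<delta>\<^sub>0 \<le> \<epsilon>"
    unfolding N_geo_def by (rule LeastI_ex)
  moreover have "L ^ n / (1 - L) * \<delta>\<^sub>0 \<le> L ^ ?N / (1 - L) * \<delta>\<^sub>0"
    using assms by (intro mult_right_mono divide_right_mono power_decreasing) auto
  ultimately show ?thesis by linarith
qed

section \<open>Superposition by \<open>F\<close> and the Dirichlet problem\<close>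

text \<open>Insert \<open>F s (x t)\<close> between \<open>F s (x s)\<close> and
  \<open>F t (x t)\<close>: the Lipschitz constant, uniform in \<open>s\<close>, controls the first
  difference, and continuity with the second argument frozen controls the other.\<close>

lemma continuous_on_lipschitz_composition:
  fixes F :: "real \<Rightarrow> real \<Rightarrow> real"
  assumes lip: "\<And>t u v. t \<in> S \<Longrightarrow> \<bar>F t u - F t v\<bar> \<le> K * \<bar>u - v\<bar>"
    and F: "\<And>u. continuous_on S (\<lambda>t. F t u)" and x: "continuous_on S x"
  shows "continuous_on S (\<lambda>t. F t (x t))"
  unfolding continuous_on_def
proof
  fix t assume t: "t \<in> S"
  have "((\<lambda>s. F s (x s) - F s (x t)) \<longlongrightarrow> 0) (at t within S)"
  proof (rule Lim_null_comparison)
    show "\<forall>\<^sub>F s in at t within S. norm (F s (x s) - F s (x t)) \<le> K * \<bar>x s - x t\<bar>"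
      using lip by (auto simp: eventually_at_filter)
    have "((\<lambda>s. K * \<bar>x s - x t\<bar>) \<longlongrightarrow> K * \<bar>x t - x t\<bar>) (at t within S)"
      using x t by (intro tendsto_intros) (auto simp: continuous_on_def)
    then show "((\<lambda>s. K * \<bar>x s - x t\<bar>) \<longlongrightarrow> 0) (at t within S)" by simp
  qed
  moreover have "((\<lambda>s. F s (x t)) \<longlongrightarrow> F t (x t)) (at t within S)"
    using F t by (auto simp: continuous_on_def)
  ultimately show "((\<lambda>s. F s (x s)) \<longlongrightarrow> F t (x t)) (at t within S)"
    using tendsto_add by fastforce
qed

text \<open>Without continuity of \<open>F\<close> in \<open>t\<close> the fixed point solves the
  equation in the Caratheodory sense; with it, classically. Uniqueness is asserted for both notions.
  Since \<open>integral\<close> has a default value on functions that are not integrable,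
  well-definedness of \<open>T\<close> is spelled out as \<open>T_integrals_exist\<close>.\<close>

theorem theorem9p4:
  fixes a b \<alpha> \<beta> L\<^sub>F M\<^sub>F\<^sub>0 M\<^sub>G L R :: real
    and F :: "real \<Rightarrow> real \<Rightarrow> real"
    and T :: "(real \<Rightarrow> real) \<Rightarrow> real \<Rightarrow> real"
    and X C :: "(real \<Rightarrow> real) set"
  assumes "a < b"
    and "X = cont_space a b"
    and "L\<^sub>F \<ge> 0"
    and "\<forall>t\<in>{a..b}. \<forall>u v. \<bar>F t u - F t v\<bar> \<le> L\<^sub>F * \<bar>u - v\<bar>"
    and "bdd_above ((\<lambda>t. \<bar>F t 0\<bar>) ` {a..b})"
    and "M\<^sub>F\<^sub>0 = (SUP t\<in>{a..b}. \<bar>F t 0\<bar>)"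
    and T_integrals_exist:
      "\<forall>x\<in>X. \<forall>t\<in>{a..b}. (\<lambda>s. green a b t s * F s (x s)) integrable_on {a..b}"
    and "T = dirichlet_op a b \<alpha> \<beta> F"
    and "bdd_above ((\<lambda>t. integral {a..b} (\<lambda>s. \<bar>green a b t s\<bar>)) ` {a..b})"
    and "M\<^sub>G = (SUP t\<in>{a..b}. integral {a..b} (\<lambda>s. \<bar>green a b t s\<bar>))"
    and "L = L\<^sub>F * M\<^sub>G"
    and "L < 1"
    and "R = (sup_norm a b (affine_interp a b \<alpha> \<beta>) + M\<^sub>G * M\<^sub>F\<^sub>0) / (1 - L)"
    and "C = {x \<in> X. sup_norm a b x \<le> R}"
  shows "\<exists>xs\<in>C.
      caratheodory_solution a b \<alpha> \<beta> F xs \<and>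
      (\<forall>y\<in>C. caratheodory_solution a b \<alpha> \<beta> F y \<longrightarrow> y = xs) \<and>
      ((\<forall>u. continuous_on {a..b} (\<lambda>t. F t u)) \<longrightarrow> classical_solution a b \<alpha> \<beta> F xs) \<and>
      (\<forall>y\<in>C. classical_solution a b \<alpha> \<beta> F y \<longrightarrow> y = xs) \<and>
      (\<forall>x :: nat \<Rightarrow> real \<Rightarrow> real. \<forall>\<delta>\<^sub>0.
         x 0 \<in> C \<and> (\<forall>n. x (Suc n) = T (x n)) \<and> \<delta>\<^sub>0 = sup_norm a b (\<lambda>t. T (x 0) t - x 0 t) \<longrightarrow>
         (\<forall>n. sup_norm a b (\<lambda>t. x n t - xs t) \<le> L ^ n / (1 - L) * \<delta>\<^sub>0) \<and>
         (\<forall>\<epsilon>>0. \<forall>n\<ge>N_geo \<epsilon> L \<delta>\<^sub>0. sup_norm a b (\<lambda>t. x n t - xs t) \<le> \<epsilon>))"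
proof -
  note ab = \<open>a < b\<close>
  have le: "a \<le> b" using ab by simp
  have lip: "\<bar>F t u - F t v\<bar> \<le> L\<^sub>F * \<bar>u - v\<bar>" if "t \<in> {a..b}" for t u v
    using assms(4) that by blast
  have F0: "\<bar>F t 0\<bar> \<le> M\<^sub>F\<^sub>0" if "t \<in> {a..b}" for t
    unfolding \<open>M\<^sub>F\<^sub>0 = _\<close> using that assms(5) by (intro cSUP_upper)
  have MG: "integral {a..b} (\<lambda>s. \<bar>green a b t s\<bar>) \<le> M\<^sub>G" if "t \<in> {a..b}" for t
    unfolding \<open>M\<^sub>G = _\<close> using that assms(9) by (intro cSUP_upper)
  have "0 \<le> integral {a..b} (\<lambda>s. \<bar>green a b a s\<bar>)"
    using continuous_on_green[OF ab]
    by (intro Henstock_Kurzweil_Integration.integral_nonneg integrable_continuous_real continuous_intros) auto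
  then have MG0: "0 \<le> M\<^sub>G" using MG[of a] le by simp
  have L0: "0 \<le> L" using MG0 \<open>L\<^sub>F \<ge> 0\<close> \<open>L = _\<close> by simp
  have XD: "continuous_on {a..b} x" "x \<in> extensional {a..b}" if "x \<in> X" for x
    using that \<open>X = _\<close> by (auto simp: cont_space_def)
  \<comment> \<open>Comparison with the second argument zero bounds \<open>F\<close> along
    \<open>x\<close>; this is the constant \<open>B\<close> handed to the lemmas on integrals and
    solutions.\<close>
  have bnd: "\<bar>F s (x s)\<bar> \<le> M\<^sub>F\<^sub>0 + L\<^sub>F * sup_norm a b x" if "x \<in> X" "s \<in> {a..b}" for x s
  proof -
    have "L\<^sub>F * \<bar>x s\<bar> \<le> L\<^sub>F * sup_norm a b x"
      using abs_le_sup_norm[OF XD(1)[OF that(1)] that(2)] \<open>L\<^sub>F \<ge> 0\<close> by (rule mult_left_mono)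
    then show ?thesis using lip[OF that(2), of "x s" 0] F0[OF that(2)] by simp
  qed
  have Gint: "(\<lambda>s. green a b t s * F s (x s)) integrable_on {a..b}" if "x \<in> X" "t \<in> {a..b}" for x t
    using T_integrals_exist that by blast
  have hint: "(\<lambda>s. F s (x s)) integrable_on {a..b}" if "x \<in> X" for x
    by (rule integrable_of_green_integrable[OF ab Gint[OF that] bnd[OF that]]) (use ab in auto)
  have TX: "T x \<in> X" if "x \<in> X" for x
  proof -
    have "continuous_on {a..b} (T x)"
      unfolding \<open>T = _\<close>
      by (rule DERIV_continuous_on[OF dirichlet_op_has_derivative[where F = F, OF ab hint bnd]])
        (use that in auto)
    moreover have "T x \<in> extensional {a..b}" by (simp add: \<open>T = _\<close> dirichlet_op_def)
    ultimately show ?thesis by (simp add: \<open>X = _\<close> cont_space_def)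
  qed
  have kernel: "\<bar>integral {a..b} (\<lambda>s. green a b t s * h s)\<bar> \<le> M\<^sub>G * B"
    if "(\<lambda>s. green a b t s * h s) integrable_on {a..b}" "\<And>s. s \<in> {a..b} \<Longrightarrow> \<bar>h s\<bar> \<le> B" "t \<in> {a..b}"
    for h t B
  proof -
    have "0 \<le> B" using that(2)[of a] le by simp
    then show ?thesis
      using abs_integral_green_le[OF ab that(1,2)] mult_right_mono[OF MG[OF that(3)], of B] by linarith
  qed

  \<comment> \<open>Contraction and the unique fixed point\<close>
  have Tdiff: "\<bar>T x t - T y t\<bar> \<le> L * D"
    if "x \<in> X" "y \<in> X" "\<And>s. s \<in> {a..b} \<Longrightarrow> \<bar>x s - y s\<bar> \<le> D" "t \<in> {a..b}" for x y t D
  proof -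
    have "T x t - T y t = integral {a..b} (\<lambda>s. green a b t s * F s (x s) - green a b t s * F s (y s))"
      using that Gint
      by (simp add: \<open>T = _\<close> dirichlet_op_def Henstock_Kurzweil_Integration.integral_diff)
    also have "\<dots> = integral {a..b} (\<lambda>s. green a b t s * (F s (x s) - F s (y s)))"
      by (simp add: right_diff_distrib)
    also have "\<bar>\<dots>\<bar> \<le> M\<^sub>G * (L\<^sub>F * D)"
    proof (rule kernel)
      show "(\<lambda>s. green a b t s * (F s (x s) - F s (y s))) integrable_on {a..b}"
        using integrable_diff[OF Gint[OF that(1,4)] Gint[OF that(2,4)]] by (simp add: right_diff_distrib)
      show "\<bar>F s (x s) - F s (y s)\<bar> \<le> L\<^sub>F * D" if "s \<in> {a..b}" for s
        using lip[OF that, of "x s" "y s"] mult_left_mono[OF \<open>\<And>s. s \<in> {a..b} \<Longrightarrow> \<bar>x s - y s\<bar> \<le> D\<close>[OF that] \<open>L\<^sub>F \<ge> 0\<close>]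
        by linarith
    qed (rule that(4))
    finally show ?thesis by (simp add: \<open>L = _\<close> mult.assoc mult.left_commute)
  qed
  have dist_ge: "\<bar>x t - y t\<bar> \<le> sup_norm a b (\<lambda>t. x t - y t)"
    if "x \<in> X" "y \<in> X" "t \<in> {a..b}" for x y t
    using abs_le_sup_norm[of a b "\<lambda>t. x t - y t" t] XD that by (auto intro: continuous_intros)
  have contr: "sup_norm a b (\<lambda>t. T x t - T y t) \<le> L * sup_norm a b (\<lambda>t. x t - y t)"
    if "x \<in> X" "y \<in> X" for x y
    using that by (intro sup_norm_le[OF le] Tdiff dist_ge)
  obtain xs where xs: "xs \<in> X" "T xs = xs"
    using cont_space_contraction_fixed_point[OF le _ \<open>L < 1\<close>, of T] TX contr \<open>X = _\<close> by blast
  have unique: "y = xs" if y: "y \<in> X" "T y = y" for y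
  proof (rule extensionalityI[OF XD(2) XD(2)])
    have "sup_norm a b (\<lambda>t. y t - xs t) \<le> L * sup_norm a b (\<lambda>t. y t - xs t)"
      using contr[OF y(1) xs(1)] y xs by simp
    then have "(1 - L) * sup_norm a b (\<lambda>t. y t - xs t) \<le> 0" by (simp add: algebra_simps)
    then have "sup_norm a b (\<lambda>t. y t - xs t) \<le> 0" using \<open>L < 1\<close> by (simp add: mult_le_0_iff)
    then show "y t = xs t" if "t \<in> {a..b}" for t using dist_ge[OF y(1) xs(1) that] by simp
  qed (use y xs in auto)
  \<comment> \<open>The fixed point equation bounds the norm by a constant plus \<open>L\<close>
    times the norm itself; moving that term to the left leaves exactly the radius
    \<open>R\<close>.\<close>
  have "sup_norm a b xs \<le> sup_norm a b (affine_interp a b \<alpha> \<beta>) + M\<^sub>G * (M\<^sub>F\<^sub>0 + L\<^sub>F * sup_norm a b xs)"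
  proof (rule sup_norm_le[OF le])
    fix t assume t: "t \<in> {a..b}"
    have "continuous_on {a..b} (affine_interp a b \<alpha> \<beta>)"
      unfolding affine_interp_def[abs_def] using ab by (intro continuous_intros) auto
    from abs_le_sup_norm[OF this t] kernel[OF Gint[OF xs(1) t] bnd[OF xs(1)] t]
    have "\<bar>affine_interp a b \<alpha> \<beta> t + integral {a..b} (\<lambda>s. green a b t s * F s (xs s))\<bar>
      \<le> sup_norm a b (affine_interp a b \<alpha> \<beta>) + M\<^sub>G * (M\<^sub>F\<^sub>0 + L\<^sub>F * sup_norm a b xs)"
      by linarith
    moreover have "xs t = affine_interp a b \<alpha> \<beta> t + integral {a..b} (\<lambda>s. green a b t s * F s (xs s))"
      using fun_cong[OF xs(2), of t] t by (simp add: \<open>T = _\<close> dirichlet_op_def)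
    ultimately show "\<bar>xs t\<bar> \<le> sup_norm a b (affine_interp a b \<alpha> \<beta>) + M\<^sub>G * (M\<^sub>F\<^sub>0 + L\<^sub>F * sup_norm a b xs)"
      by simp
  qed
  then have "(1 - L) * sup_norm a b xs \<le> sup_norm a b (affine_interp a b \<alpha> \<beta>) + M\<^sub>G * M\<^sub>F\<^sub>0"
    by (simp add: \<open>L = _\<close> algebra_simps)
  then have "sup_norm a b xs \<le> R"
    using \<open>L < 1\<close> by (simp add: \<open>R = _\<close> pos_le_divide_eq mult.commute)
  then have xsC: "xs \<in> C" using xs \<open>C = _\<close> by simp
  have fp: "dirichlet_op a b \<alpha> \<beta> F xs = xs" using xs \<open>T = _\<close> by simp
  have CX: "y \<in> X" if "y \<in> C" for y using that \<open>C = _\<close> by simp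
  \<comment> \<open>Uniqueness is obtained on all of \<open>X\<close>; classical solutions are
    reduced to this case because they are Caratheodory solutions.\<close>
  have cara: "y = xs" if "y \<in> X" "caratheodory_solution a b \<alpha> \<beta> F y" for y
    using unique[OF that(1)] that \<open>T = _\<close>
      caratheodory_imp_fixed_point[where F = F, OF ab hint[OF that(1)] bnd[OF that(1)] XD(2)[OF that(1)] that(2)]
    by blast
  show ?thesis
  proof (intro bexI[OF _ xsC] conjI allI ballI impI)
    show "caratheodory_solution a b \<alpha> \<beta> F xs"
      by (rule fixed_point_imp_caratheodory[where F = F, OF ab hint[OF xs(1)] bnd[OF xs(1)] fp])
    show "y = xs" if "y \<in> C" "caratheodory_solution a b \<alpha> \<beta> F y" for y
      using cara CX that by blast
    show "y = xs" if "y \<in> C" "classical_solution a b \<alpha> \<beta> F y" for y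
      using cara[OF CX[OF that(1)] classical_imp_caratheodory[where F = F, OF bnd[OF CX[OF that(1)]] that(2)]] .
    show "classical_solution a b \<alpha> \<beta> F xs" if "\<forall>u. continuous_on {a..b} (\<lambda>t. F t u)"
    proof (rule fixed_point_imp_classical[where F = F, OF ab _ bnd[OF xs(1)] fp])
      show "continuous_on {a..b} (\<lambda>s. F s (xs s))"
        using that by (intro continuous_on_lipschitz_composition[OF lip _ XD(1)[OF xs(1)]]) auto
    qed
  next

    \<comment> \<open>Convergence of the Picard iterates\<close>
    fix x :: "nat \<Rightarrow> real \<Rightarrow> real" and \<delta>\<^sub>0 n
    assume x: "x 0 \<in> C \<and> (\<forall>n. x (Suc n) = T (x n)) \<and> \<delta>\<^sub>0 = sup_norm a b (\<lambda>t. T (x 0) t - x 0 t)"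
    have xX: "x n \<in> X" for n
      by (induction n) (use x CX TX in auto)
    have \<delta>: "\<bar>x 1 t - x 0 t\<bar> \<le> \<delta>\<^sub>0" if "t \<in> {a..b}" for t
      using dist_ge[OF xX xX that, of 1 0] x by simp
    have bound: "sup_norm a b (\<lambda>t. x n t - xs t) \<le> L ^ n / (1 - L) * \<delta>\<^sub>0" for n
    proof (rule picard_error_bound[OF L0 \<open>L < 1\<close>])
      show "sup_norm a b (\<lambda>t. x (Suc n) t - xs t) \<le> L * sup_norm a b (\<lambda>t. x n t - xs t)" for n
        using contr[OF xX[of n] xs(1)] x xs(2) by simp
      show "sup_norm a b (\<lambda>t. x 0 t - xs t) \<le> \<delta>\<^sub>0 + sup_norm a b (\<lambda>t. x 1 t - xs t)"
      proof (rule sup_norm_le[OF le])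
        show "\<bar>x 0 t - xs t\<bar> \<le> \<delta>\<^sub>0 + sup_norm a b (\<lambda>t. x 1 t - xs t)" if "t \<in> {a..b}" for t
          using dist_ge[OF xX[of 1] xs(1) that] \<delta>[OF that] by linarith
      qed
    qed
    then show "sup_norm a b (\<lambda>t. x n t - xs t) \<le> L ^ n / (1 - L) * \<delta>\<^sub>0" .
    fix \<epsilon> :: real assume "\<epsilon> > 0" "N_geo \<epsilon> L \<delta>\<^sub>0 \<le> n"
    moreover have "0 \<le> \<delta>\<^sub>0" using \<delta>[of a] le by simp
    ultimately have "L ^ n / (1 - L) * \<delta>\<^sub>0 \<le> \<epsilon>" using N_geo_bound[OF L0 \<open>L < 1\<close>] by blast
    then show "sup_norm a b (\<lambda>t. x n t - xs t) \<le> \<epsilon>" using bound[of n] by linarith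
  qed
qed

end
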